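(* Let $T>0$, $n\in\mathbb{N}$, $d\in\mathbb{N}$, and let $X=C^{d}([0,T],\mathbb{R}^n)$. Let $\tilde H$ be a (real) scalar valued reproducing kernel Hilbert space (RKHS) over $\mathbb{R}^n$. Suppose there exists a scalar valued RKHS $\mathcal{Y}$ over $[0,T]$ such that, for every $\theta\in X$, the composition operator $C_\theta:\tilde H\to\mathcal{Y}$, $C_\theta g=g\circ\theta$, is a bounded operator. Define the vector space $$H(X):=\{\phi_g : g\in\tilde H\}$$ of mappings $\phi_g:X\to\mathcal{Y}$ given by $\phi_g[\theta]:=g(\theta(\cdot))$, together with the inner product induced by $\tilde H$, $$\langle \phi_{g_1},\phi_{g_2}\rangle_{H}=\langle g_1,g_2\rangle_{\tilde H}.$$ Then $H(X)$ is a vector valued reproducing kernel Hilbert space of functions from $X$ to $\mathcal{Y}$.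
   Context: Given a Hilbert space $\mathcal{Y}$ and a set $X$, a vector valued reproducing kernel Hilbert space (vvRKHS) is a Hilbert space $H$ of functions mapping $X$ to $\mathcal{Y}$ such that for each $x\in X$ and $v\in\mathcal{Y}$ the functional $g\mapsto\langle g(x),v\rangle_{\mathcal{Y}}$ is bounded on $H$. A scalar valued RKHS over a set $S$ is a Hilbert space of real valued functions on $S$ for which every point evaluation functional is bounded. $C^d([0,T],\mathbb{R}^n)$ denotes the set of $d$ times continuously differentiable functions from $[0,T]$ to $\mathbb{R}^n$. *)

theory Defs
  imports "HOL-Analysis.Analysis" "HOL-Library.Function_Algebras"
begin

section \<open>Functions as a real vector space\<close>

instantiation "fun" :: (type, real_vector) real_vector
begin

definition scaleR_fun :: "real \<Rightarrow> ('a \<Rightarrow> 'b) \<Rightarrow> 'a \<Rightarrow> 'b" where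
  "scaleR_fun c f = (\<lambda>x. c *\<^sub>R f x)"

instance
  by standard (simp_all add: scaleR_fun_def fun_eq_iff scaleR_add_right scaleR_add_left)

end

lemma scaleR_fun_apply [simp]: "(c *\<^sub>R f) x = c *\<^sub>R f x"
  by (simp add: scaleR_fun_def)

text \<open>
  Domains such as \<open>{0..T}\<close> and \<open>X\<close> are sets, not types. A function on a set \<open>S\<close> with values in a
  vector space is represented throughout by its extension by 0 to the whole type. This
  representation is unique, and, unlike the one by \<^const>\<open>extensional\<close> functions, these functions
  are closed under the pointwise operations.
\<close>

definition supported_on :: "'a set \<Rightarrow> ('a \<Rightarrow> 'b::zero) \<Rightarrow> bool" where
  "supported_on S f \<longleftrightarrow> (\<forall>x. x \<notin> S \<longrightarrow> f x = 0)"

section \<open>Real Hilbert spaces on a carrier set\<close>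

text \<open>
  The inner product is only meaningful on the carrier \<open>V\<close>, a linear subspace of an ambient type
  that carries no topology of its own.
\<close>

definition inner_product_on :: "'a::real_vector set \<Rightarrow> ('a \<Rightarrow> 'a \<Rightarrow> real) \<Rightarrow> bool" where
  "inner_product_on V ip \<longleftrightarrow>
     subspace V \<and>
     (\<forall>f\<in>V. \<forall>g\<in>V. ip f g = ip g f) \<and>
     (\<forall>f\<in>V. \<forall>g\<in>V. \<forall>h\<in>V. ip (f + g) h = ip f h + ip g h) \<and>
     (\<forall>c. \<forall>f\<in>V. \<forall>g\<in>V. ip (c *\<^sub>R f) g = c * ip f g) \<and>
     (\<forall>f\<in>V. 0 \<le> ip f f) \<and>
     (\<forall>f\<in>V. ip f f = 0 \<longleftrightarrow> f = 0)"

definition ip_norm :: "('a \<Rightarrow> 'a \<Rightarrow> real) \<Rightarrow> 'a \<Rightarrow> real" where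
  "ip_norm ip f = sqrt (ip f f)"

text \<open>
  \<^locale>\<open>Metric_space\<close> demands nonnegativity and symmetry also outside the carrier, hence the case
  distinction.
\<close>

definition ip_dist :: "'a::real_vector set \<Rightarrow> ('a \<Rightarrow> 'a \<Rightarrow> real) \<Rightarrow> 'a \<Rightarrow> 'a \<Rightarrow> real" where
  "ip_dist V ip f g = (if f \<in> V \<and> g \<in> V then ip_norm ip (f - g) else 0)"

lemma Metric_space_ip_dist:
  assumes "inner_product_on V ip"
  shows "Metric_space V (ip_dist V ip)"
proof -
  have sub: "subspace V" and sym: "\<And>f g. f \<in> V \<Longrightarrow> g \<in> V \<Longrightarrow> ip f g = ip g f"
    and add: "\<And>f g h. f \<in> V \<Longrightarrow> g \<in> V \<Longrightarrow> h \<in> V \<Longrightarrow> ip (f + g) h = ip f h + ip g h"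
    and scale: "\<And>c f g. f \<in> V \<Longrightarrow> g \<in> V \<Longrightarrow> ip (c *\<^sub>R f) g = c * ip f g"
    and nonneg: "\<And>f. f \<in> V \<Longrightarrow> 0 \<le> ip f f"
    and def0: "\<And>f. f \<in> V \<Longrightarrow> ip f f = 0 \<longleftrightarrow> f = 0"
    using assms by (auto simp: inner_product_on_def)
  note mem = subspace_add[OF sub] subspace_diff[OF sub] subspace_scale[OF sub]
  have expand: "ip (f + c *\<^sub>R g) (f + c *\<^sub>R g) = ip f f + 2 * c * ip f g + c^2 * ip g g"
    if "f \<in> V" "g \<in> V" for f g c
  proof -
    have "ip (f + c *\<^sub>R g) (f + c *\<^sub>R g) = ip f (f + c *\<^sub>R g) + c * ip g (f + c *\<^sub>R g)"
      using that by (simp add: add scale mem)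
    also have "ip f (f + c *\<^sub>R g) = ip f f + c * ip f g"
      using that by (metis add scale sym mem(1,3))
    also have "ip g (f + c *\<^sub>R g) = ip f g + c * ip g g"
      using that by (metis add scale sym mem(1,3))
    finally show ?thesis by (simp add: algebra_simps power2_eq_square)
  qed
  have cs: "ip f g \<le> ip_norm ip f * ip_norm ip g" if fg: "f \<in> V" "g \<in> V" for f g
  proof (cases "ip g g = 0")
    case True
    then have "g = 0" using def0 fg by simp
    then have "ip g f = 0" using scale[of f f 0] fg by simp
    then show ?thesis using sym fg nonneg by (simp add: ip_norm_def)
  next
    case False
    then have pos: "ip g g > 0" using nonneg[of g] fg by simp
    define c where "c = - ip f g / ip g g"
    have "0 \<le> ip f f + 2 * c * ip f g + c^2 * ip g g"
      using nonneg[of "f + c *\<^sub>R g"] fg by (simp add: mem expand)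
    also have "\<dots> = ip f f - (ip f g)^2 / ip g g"
      using pos by (simp add: c_def field_simps power2_eq_square)
    finally have "(ip f g)^2 \<le> ip f f * ip g g"
      using pos by (simp add: field_simps)
    then show ?thesis
      unfolding ip_norm_def real_sqrt_mult[symmetric] by (rule real_le_rsqrt)
  qed
  have tri: "ip_norm ip (f + g) \<le> ip_norm ip f + ip_norm ip g" if fg: "f \<in> V" "g \<in> V" for f g
    unfolding ip_norm_def
  proof (rule real_le_lsqrt)
    have "ip (f + g) (f + g) = ip f f + 2 * ip f g + ip g g"
      using expand[OF fg, of 1] by simp
    also have "\<dots> \<le> (sqrt (ip f f) + sqrt (ip g g))\<^sup>2"
      using cs[OF fg] nonneg fg by (simp add: power2_sum ip_norm_def)
    finally show "ip (f + g) (f + g) \<le> (sqrt (ip f f) + sqrt (ip g g))\<^sup>2" .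
  qed (use nonneg fg in auto)
  have neg: "ip_norm ip (f - g) = ip_norm ip (g - f)" if "f \<in> V" "g \<in> V" for f g
    using expand[of 0 "f - g" "-1"] that mem(2)[of f g] subspace_0[OF sub]
      scale[of 0 0 0] scale[of 0 "f - g" 0]
    by (simp add: ip_norm_def)
  show ?thesis
  proof
    fix f g h
    show "0 \<le> ip_dist V ip f g"
      using nonneg mem(2) by (simp add: ip_dist_def ip_norm_def)
    show "ip_dist V ip f g = ip_dist V ip g f"
      using neg by (simp add: ip_dist_def)
    show "ip_dist V ip f g = 0 \<longleftrightarrow> f = g" if "f \<in> V" "g \<in> V"
      using that def0 mem(2) by (simp add: ip_dist_def ip_norm_def)
    show "ip_dist V ip f h \<le> ip_dist V ip f g + ip_dist V ip g h" if "f \<in> V" "g \<in> V" "h \<in> V"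
      using that tri[of "f - g" "g - h"] mem(2) by (simp add: ip_dist_def)
  qed
qed

definition hilbert_space_on :: "'a::real_vector set \<Rightarrow> ('a \<Rightarrow> 'a \<Rightarrow> real) \<Rightarrow> bool" where
  "hilbert_space_on V ip \<longleftrightarrow>
     inner_product_on V ip \<and> Metric_space.mcomplete V (ip_dist V ip)"

definition bounded_operator_on ::
  "'a::real_vector set \<Rightarrow> ('a \<Rightarrow> 'a \<Rightarrow> real) \<Rightarrow> 'b::real_vector set \<Rightarrow> ('b \<Rightarrow> 'b \<Rightarrow> real)
    \<Rightarrow> ('a \<Rightarrow> 'b) \<Rightarrow> bool" where
  "bounded_operator_on V ipV W ipW A \<longleftrightarrow>
     A ` V \<subseteq> W \<and>
     (\<forall>f\<in>V. \<forall>g\<in>V. A (f + g) = A f + A g) \<and>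
     (\<forall>c. \<forall>f\<in>V. A (c *\<^sub>R f) = c *\<^sub>R A f) \<and>
     (\<exists>K. \<forall>f\<in>V. ip_norm ipW (A f) \<le> K * ip_norm ipV f)"

abbreviation bounded_functional_on ::
  "'a::real_vector set \<Rightarrow> ('a \<Rightarrow> 'a \<Rightarrow> real) \<Rightarrow> ('a \<Rightarrow> real) \<Rightarrow> bool" where
  "bounded_functional_on V ip l \<equiv> bounded_operator_on V ip UNIV inner l"

section \<open>Reproducing kernel Hilbert spaces\<close>

definition scalar_rkhs ::
  "'s set \<Rightarrow> ('s \<Rightarrow> real) set \<Rightarrow> (('s \<Rightarrow> real) \<Rightarrow> ('s \<Rightarrow> real) \<Rightarrow> real) \<Rightarrow> bool" where
  "scalar_rkhs S H ip \<longleftrightarrow>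
     hilbert_space_on H ip \<and>
     (\<forall>f\<in>H. supported_on S f) \<and>
     (\<forall>x\<in>S. bounded_functional_on H ip (\<lambda>f. f x))"

definition vv_rkhs ::
  "'x set \<Rightarrow> 'y::real_vector set \<Rightarrow> ('y \<Rightarrow> 'y \<Rightarrow> real)
    \<Rightarrow> ('x \<Rightarrow> 'y) set \<Rightarrow> (('x \<Rightarrow> 'y) \<Rightarrow> ('x \<Rightarrow> 'y) \<Rightarrow> real) \<Rightarrow> bool" where
  "vv_rkhs X Y ipY H ip \<longleftrightarrow>
     hilbert_space_on Y ipY \<and>
     hilbert_space_on H ip \<and>
     (\<forall>F\<in>H. F ` X \<subseteq> Y \<and> supported_on X F) \<and>
     (\<forall>x\<in>X. \<forall>v\<in>Y. bounded_functional_on H ip (\<lambda>F. ipY (F x) v))"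

section \<open>Trajectories and composition\<close>

text \<open>At boundary points of \<open>S\<close>, derivatives are taken within \<open>S\<close>.\<close>

primrec cont_diff_on :: "nat \<Rightarrow> real set \<Rightarrow> (real \<Rightarrow> 'a::real_normed_vector) \<Rightarrow> bool" where
  "cont_diff_on 0 S f \<longleftrightarrow> continuous_on S f"
| "cont_diff_on (Suc k) S f \<longleftrightarrow>
     (\<exists>f'. (\<forall>t\<in>S. (f has_vector_derivative f' t) (at t within S)) \<and> cont_diff_on k S f')"

definition cont_diff_space :: "nat \<Rightarrow> real set \<Rightarrow> (real \<Rightarrow> 'a::real_normed_vector) set" where
  "cont_diff_space d S = {\<theta>. supported_on S \<theta> \<and> cont_diff_on d S \<theta>}"

definition composition_op :: "'t set \<Rightarrow> ('t \<Rightarrow> 's) \<Rightarrow> ('s \<Rightarrow> real) \<Rightarrow> 't \<Rightarrow> real" where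
  "composition_op S \<theta> g = (\<lambda>t. if t \<in> S then g (\<theta> t) else 0)"

definition phi ::
  "('t \<Rightarrow> 's) set \<Rightarrow> 't set \<Rightarrow> ('s \<Rightarrow> real) \<Rightarrow> ('t \<Rightarrow> 's) \<Rightarrow> 't \<Rightarrow> real" where
  "phi X S g = (\<lambda>\<theta>. if \<theta> \<in> X then composition_op S \<theta> g else 0)"

text \<open>
  The form on \<open>\<Phi> ` V\<close> given by \<open>\<langle>\<Phi> f, \<Phi> g\<rangle> = ip f g\<close>. It is determined by this rule only if the
  value does not depend on the chosen preimages, which has to be proved in each case.
\<close>

definition induced_inner ::
  "('a \<Rightarrow> 'b) \<Rightarrow> 'a set \<Rightarrow> ('a \<Rightarrow> 'a \<Rightarrow> real) \<Rightarrow> 'b \<Rightarrow> 'b \<Rightarrow> real" where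
  "induced_inner \<Phi> V ip F G = (THE c. \<exists>f\<in>V. \<exists>g\<in>V. F = \<Phi> f \<and> G = \<Phi> g \<and> c = ip f g)"

end

theory Submission
  imports Defs
begin

text \<open>
  A curve constant on \<open>[0,T]\<close> is smooth, so \<open>g\<close> can be read off \<open>\<phi>\<^sub>g\<close> by evaluating at constant
  curves. Hence \<open>g \<mapsto> \<phi>\<^sub>g\<close> is a linear bijection of the scalar space onto \<open>H(X)\<close>, the induced form is
  well defined, and the Hilbert space structure is transported. The functional
  \<open>\<phi>\<^sub>g \<mapsto> \<langle>\<phi>\<^sub>g[\<theta>], v\<rangle>\<close> is bounded by Cauchy-Schwarz in the range space and boundedness of the
  composition operator of \<open>\<theta>\<close>.
\<close>

text \<open>The squared norm of \<open>f + c *\<^sub>R g\<close> is a quadratic in \<open>c\<close>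
  whose minimum is nonnegative. This is applied in the range space to bound the functionals.\<close>

lemma inner_product_on_Cauchy_Schwarz:
  assumes ip: "inner_product_on V ip" and f: "f \<in> V" and g: "g \<in> V"
  shows "\<bar>ip f g\<bar> \<le> ip_norm ip f * ip_norm ip g"
proof (cases "g = 0")
  case True
  have "ip 0 f = 0" "ip g g = 0"
    using ip f g True unfolding inner_product_on_def by (metis mult_zero_left scaleR_zero_left, metis)
  moreover have "ip f g = ip g f"
    using ip f g by (simp add: inner_product_on_def)
  ultimately show ?thesis using True by (simp add: ip_norm_def)
next
  case False
  have sub: "subspace V" and sym: "\<And>f g. f \<in> V \<Longrightarrow> g \<in> V \<Longrightarrow> ip f g = ip g f"
    and add: "\<And>f g h. f \<in> V \<Longrightarrow> g \<in> V \<Longrightarrow> h \<in> V \<Longrightarrow> ip (f + g) h = ip f h + ip g h"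
    and scale: "\<And>c f g. f \<in> V \<Longrightarrow> g \<in> V \<Longrightarrow> ip (c *\<^sub>R f) g = c * ip f g"
    and nonneg: "\<And>f. f \<in> V \<Longrightarrow> 0 \<le> ip f f"
    and def0: "\<And>f. f \<in> V \<Longrightarrow> ip f f = 0 \<longleftrightarrow> f = 0"
    using ip by (auto simp: inner_product_on_def)
  have pos: "ip g g > 0"
    using nonneg[OF g] def0[OF g] False by simp
  \<comment> \<open>The minimiser of that quadratic: it makes \<open>f + c *\<^sub>R g\<close>
    orthogonal to \<open>g\<close>.\<close>
  define c where "c = - ip f g / ip g g"
  have cg: "c *\<^sub>R g \<in> V" and h: "f + c *\<^sub>R g \<in> V"
    using subspace_add[OF sub] subspace_scale[OF sub] f g by auto
  have "0 \<le> ip (f + c *\<^sub>R g) (f + c *\<^sub>R g)"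
    by (rule nonneg[OF h])
  also have "\<dots> = ip (f + c *\<^sub>R g) f + c * ip (f + c *\<^sub>R g) g"
    using add[OF f cg h] scale[OF g h] sym[OF f h] sym[OF g h] by simp
  also have "\<dots> = ip f f + 2 * c * ip f g + c\<^sup>2 * ip g g"
    using add[OF f cg f] add[OF f cg g] scale[OF g f] scale[OF g g] sym[OF g f]
    by (simp add: algebra_simps power2_eq_square)
  also have "\<dots> = ip f f - (ip f g)\<^sup>2 / ip g g"
    using pos by (simp add: c_def field_simps power2_eq_square)
  finally have "(ip f g)\<^sup>2 \<le> ip f f * ip g g"
    using pos by (simp add: field_simps)
  then have "sqrt ((ip f g)\<^sup>2) \<le> sqrt (ip f f * ip g g)"
    by (rule real_sqrt_le_mono)
  then show ?thesis
    by (simp add: ip_norm_def real_sqrt_mult)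
qed

text \<open>Injectivity makes the preimages unique, so the definite description has exactly one
  candidate.\<close>

lemma induced_inner_eq:
  assumes "inj_on \<Phi> V" "f \<in> V" "g \<in> V"
  shows "induced_inner \<Phi> V ip (\<Phi> f) (\<Phi> g) = ip f g"
  unfolding induced_inner_def using assms
  by (intro the_equality) (auto simp: inj_on_eq_iff)

context
  fixes \<Phi> :: "'a::real_vector \<Rightarrow> 'b::real_vector" and V and ip :: "'a \<Rightarrow> 'a \<Rightarrow> real"
  assumes inj: "inj_on \<Phi> V"
    and lin_add: "\<And>f g. f \<in> V \<Longrightarrow> g \<in> V \<Longrightarrow> \<Phi> (f + g) = \<Phi> f + \<Phi> g"
    and lin_scale: "\<And>c f. f \<in> V \<Longrightarrow> \<Phi> (c *\<^sub>R f) = c *\<^sub>R \<Phi> f"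
begin

text \<open>Each axiom pulls back to \<open>V\<close> along the linear map. Definiteness also uses
  injectivity: only 0 is sent to 0.\<close>

lemma inner_product_on_induced:
  assumes ip: "inner_product_on V ip"
  shows "inner_product_on (\<Phi> ` V) (induced_inner \<Phi> V ip)"
proof -
  have sub: "subspace V" using ip by (simp add: inner_product_on_def)
  note mem = subspace_0[OF sub] subspace_add[OF sub] subspace_scale[OF sub]
  have zero: "\<Phi> 0 = 0"
    using lin_scale[of 0 0] mem(1) by simp
  have "subspace (\<Phi> ` V)"
    unfolding subspace_def
    using mem by (auto simp: lin_add[symmetric] lin_scale[symmetric] zero[symmetric])
  moreover have "\<Phi> f = 0 \<longleftrightarrow> f = 0" if "f \<in> V" for f
    using inj_on_eq_iff[OF inj that mem(1)] zero by simp
  ultimately show ?thesis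
    using ip mem unfolding inner_product_on_def
    by (intro conjI) (auto simp: induced_inner_eq[OF inj] lin_add[symmetric] lin_scale[symmetric])
qed

lemma ip_dist_induced:
  assumes "subspace V" "f \<in> V" "g \<in> V"
  shows "ip_dist (\<Phi> ` V) (induced_inner \<Phi> V ip) (\<Phi> f) (\<Phi> g) = ip_dist V ip f g"
proof -
  have "\<Phi> (f - g) = \<Phi> f - \<Phi> g"
    \<comment> \<open>Only addition and scaling are assumed to be preserved, so the difference is
      written as a sum with \<open>(-1) *\<^sub>R g\<close>.\<close>
    using lin_add[of f "(-1) *\<^sub>R g"] lin_scale[of g "-1"] subspace_scale[of V g "-1"] assms by simp
  moreover have "f - g \<in> V"
    using assms by (simp add: subspace_diff)
  ultimately show ?thesis
    using assms induced_inner_eq[OF inj, of "f - g" "f - g" ip] by (simp add: ip_dist_def ip_norm_def)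
qed

text \<open>Since \<Phi> is an isometry onto its image, a Cauchy sequence there lifts to a Cauchy
  sequence in \<open>V\<close>, and the image of the limit of the lift is a limit.\<close>

lemma hilbert_space_on_induced:
  assumes hs: "hilbert_space_on V ip"
  shows "hilbert_space_on (\<Phi> ` V) (induced_inner \<Phi> V ip)"
proof -
  have ip: "inner_product_on V ip" and sub: "subspace V"
    using hs by (auto simp: hilbert_space_on_def inner_product_on_def)
  interpret V: Metric_space V "ip_dist V ip"
    by (rule Metric_space_ip_dist[OF ip])
  interpret W: Metric_space "\<Phi> ` V" "ip_dist (\<Phi> ` V) (induced_inner \<Phi> V ip)"
    by (rule Metric_space_ip_dist[OF inner_product_on_induced[OF ip]])
  note dist = ip_dist_induced[OF sub]
  have "W.mcomplete"
    unfolding W.mcomplete_def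
  proof (intro allI impI)
    fix \<sigma> assume cauchy: "W.MCauchy \<sigma>"
    \<comment> \<open>\<open>MCauchy\<close> includes that the sequence stays in the carrier, so
      preimages can be chosen termwise.\<close>
    then have "\<forall>n. \<exists>f\<in>V. \<sigma> n = \<Phi> f"
      unfolding W.MCauchy_def by blast
    then obtain \<tau> where \<tau>: "\<And>n. \<tau> n \<in> V" "\<And>n. \<sigma> n = \<Phi> (\<tau> n)"
      by metis
    have "V.MCauchy \<tau>"
      using cauchy \<tau> by (auto simp: V.MCauchy_def W.MCauchy_def dist)
    moreover have "V.mcomplete"
      using hs by (simp add: hilbert_space_on_def)
    ultimately obtain f where "limitin V.mtopology \<tau> f sequentially"
      unfolding V.mcomplete_def by blast
    then have "limitin W.mtopology \<sigma> (\<Phi> f) sequentially"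
      using \<tau> by (auto simp: V.limitin_metric W.limitin_metric dist)
    then show "\<exists>x. limitin W.mtopology \<sigma> x sequentially" ..
  qed
  then show ?thesis
    using inner_product_on_induced[OF ip] by (simp add: hilbert_space_on_def)
qed

end

text \<open>Constancy is asked only on \<open>S\<close>, because the curves of interest are cut off
  to 0 outside. The induction varies \<open>f\<close> and \<open>c\<close>: the derivative is again
  a constant, namely 0.\<close>

lemma cont_diff_on_const:
  fixes f :: "real \<Rightarrow> 'a::real_normed_vector"
  assumes "\<And>t. t \<in> S \<Longrightarrow> f t = c"
  shows "cont_diff_on d S f"
  using assms
proof (induction d arbitrary: f c)
  case 0
  then have "continuous_on S f \<longleftrightarrow> continuous_on S (\<lambda>_. c)"
    by (intro continuous_on_cong) auto
  then show ?case by simp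
next
  case (Suc d)
  have "(f has_vector_derivative 0) (at t within S)" if "t \<in> S" for t
    by (rule has_vector_derivative_transform[OF that _ has_vector_derivative_const[of c]])
      (simp add: Suc.prems)
  moreover have "cont_diff_on d S (\<lambda>_. 0 :: 'a)"
    by (rule Suc.IH) simp
  ultimately show ?case
    unfolding cont_diff_on.simps by (intro exI[of _ "\<lambda>_. 0"]) blast
qed

lemma const_in_cont_diff_space:
  "(\<lambda>t. if t \<in> S then c else 0) \<in> cont_diff_space d S"
  by (simp add: cont_diff_space_def supported_on_def cont_diff_on_const)

lemma phi_add: "phi X S (f + g) = phi X S f + phi X S g"
  by (auto simp: phi_def composition_op_def fun_eq_iff)

lemma phi_scaleR: "phi X S (c *\<^sub>R g) = c *\<^sub>R phi X S g"
  by (auto simp: phi_def composition_op_def fun_eq_iff)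

text \<open>A point of \<open>S\<close> provides a time at which a constant curve can be read; for
  empty \<open>S\<close> every \<open>phi X S g\<close> would be 0.\<close>

lemma inj_phi:
  assumes "S \<noteq> {}"
  shows "inj (phi (cont_diff_space d S) S)"
proof (rule injI)
  fix f g :: "'a \<Rightarrow> real"
  assume eq: "phi (cont_diff_space d S) S f = phi (cont_diff_space d S) S g"
  obtain t where t: "t \<in> S" using assms by blast
  show "f = g"
  proof
    fix a
    show "f a = g a"
      using fun_cong[OF fun_cong[OF eq, of "\<lambda>t. if t \<in> S then a else 0"], of t] t
      by (simp add: phi_def const_in_cont_diff_space composition_op_def)
  qed
qed

text \<open>Here \<open>X\<close> may be any set of curves; the smoothness class enters only through
  injectivity of \<open>phi X S\<close>.\<close>

lemma vv_rkhs_phi: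
  assumes inj: "inj_on (phi X S) H"
    and H: "hilbert_space_on H ip" and Y: "hilbert_space_on Y ipY"
    and bdd: "\<And>\<theta>. \<theta> \<in> X \<Longrightarrow> bounded_operator_on H ip Y ipY (composition_op S \<theta>)"
  shows "vv_rkhs X Y ipY (phi X S ` H) (induced_inner (phi X S) H ip)"
proof -
  let ?ip = "induced_inner (phi X S) H ip"
  have ipY: "inner_product_on Y ipY"
    using Y by (simp add: hilbert_space_on_def)
  have inY: "composition_op S \<theta> g \<in> Y" if "\<theta> \<in> X" "g \<in> H" for \<theta> g
    using bdd[OF that(1)] that(2) by (auto simp: bounded_operator_on_def)
  have phiY: "phi X S g \<theta> \<in> Y" if "\<theta> \<in> X" "g \<in> H" for \<theta> g
    using inY that by (simp add: phi_def)
  have norm: "ip_norm ?ip (phi X S g) = ip_norm ip g" if "g \<in> H" for g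
    using that by (simp add: ip_norm_def induced_inner_eq[OF inj])
  have "bounded_functional_on (phi X S ` H) ?ip (\<lambda>F. ipY (F \<theta>) v)"
    if \<theta>: "\<theta> \<in> X" and v: "v \<in> Y" for \<theta> v
  proof -
    obtain K where K: "\<And>g. g \<in> H \<Longrightarrow> ip_norm ipY (composition_op S \<theta> g) \<le> K * ip_norm ip g"
      using bdd[OF \<theta>] unfolding bounded_operator_on_def by blast
    \<comment> \<open>The sign of \<open>K\<close> is unknown, so the bound on the composition
      operator is multiplied by this norm, which is nonnegative.\<close>
    have nonneg: "0 \<le> ip_norm ipY v"
      using ipY v by (simp add: ip_norm_def inner_product_on_def)
    have bound: "\<bar>ipY (phi X S g \<theta>) v\<bar> \<le> (K * ip_norm ipY v) * ip_norm ip g" if g: "g \<in> H" for g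
    proof -
      have "\<bar>ipY (phi X S g \<theta>) v\<bar> \<le> ip_norm ipY (composition_op S \<theta> g) * ip_norm ipY v"
        using inner_product_on_Cauchy_Schwarz[OF ipY inY[OF \<theta> g] v] \<theta> by (simp add: phi_def)
      also have "\<dots> \<le> (K * ip_norm ip g) * ip_norm ipY v"
        by (rule mult_right_mono[OF K[OF g] nonneg])
      finally show ?thesis by (simp add: mult_ac)
    qed
    have "\<forall>F\<in>phi X S ` H. ip_norm inner (ipY (F \<theta>) v) \<le> (K * ip_norm ipY v) * ip_norm ?ip F"
      \<comment> \<open>On the reals \<open>ip_norm inner\<close> is the absolute value.\<close>
      using bound by (auto simp: norm) (simp add: ip_norm_def)
    then show ?thesis
      unfolding bounded_operator_on_def
      using ipY phiY[OF \<theta>] v by (auto simp: inner_product_on_def)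
  qed
  moreover have "supported_on X (phi X S g)" for g
    by (simp add: supported_on_def phi_def)
  ultimately show ?thesis
    unfolding vv_rkhs_def
    using Y hilbert_space_on_induced[OF inj phi_add phi_scaleR H] phiY by auto
qed

text \<open>The first conjunct certifies that the definite description behind
  \<open>induced_inner\<close> obeys the prescribed rule, so the second speaks of the intended inner
  product.\<close>

theorem theorem1:
  fixes T :: real and d :: nat
    and X :: "(real \<Rightarrow> real ^ 'n) set"
    and Ht :: "(real ^ 'n \<Rightarrow> real) set"
    and ipHt :: "(real ^ 'n \<Rightarrow> real) \<Rightarrow> (real ^ 'n \<Rightarrow> real) \<Rightarrow> real"
    and Y :: "(real \<Rightarrow> real) set"
    and ipY :: "(real \<Rightarrow> real) \<Rightarrow> (real \<Rightarrow> real) \<Rightarrow> real"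
  defines "X \<equiv> cont_diff_space d {0..T}"
  assumes "T > 0"
    and "scalar_rkhs UNIV Ht ipHt"
    and "scalar_rkhs {0..T} Y ipY"
    and "\<And>\<theta>. \<theta> \<in> X \<Longrightarrow> bounded_operator_on Ht ipHt Y ipY (composition_op {0..T} \<theta>)"
  shows "(\<forall>g1\<in>Ht. \<forall>g2\<in>Ht.
            induced_inner (phi X {0..T}) Ht ipHt (phi X {0..T} g1) (phi X {0..T} g2) = ipHt g1 g2) \<and>
         vv_rkhs X Y ipY (phi X {0..T} ` Ht) (induced_inner (phi X {0..T}) Ht ipHt)"
proof -
  have "inj (phi X {0..T})"
    \<comment> \<open>Positivity of \<open>T\<close> makes the interval nonempty.\<close>
    unfolding X_def using \<open>T > 0\<close> by (intro inj_phi) simp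
  then have inj: "inj_on (phi X {0..T}) Ht"
    by (rule inj_on_subset) simp
  have "vv_rkhs X Y ipY (phi X {0..T} ` Ht) (induced_inner (phi X {0..T}) Ht ipHt)"
    using assms(3-5) by (intro vv_rkhs_phi[OF inj]) (auto simp: scalar_rkhs_def)
  then show ?thesis
    using induced_inner_eq[OF inj] by blast
qed

end
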